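(* The complete extended Tutte invariant is well defined for an alternating dimap $D$ if and only if every edge of $D$ is a triloop.
   Context: An alternating dimap is a directed graph (loops and multiple edges allowed) 2-cell embedded in a disjoint union of orientable closed surfaces such that around every vertex the incident edge-ends alternate between incoming and outgoing; every face is a c-face (clockwise boundary) or an a-face (anticlockwise boundary). The empty alternating dimap has no vertices, edges or faces. For an edge $e=uv$, its right (resp. left) successor is the next edge after $e$ around the c-face (resp. a-face) containing $e$. Edge types: 1-loop (head has degree 2); $\omega$-loop (alone forms an a-face); $\omega^2$-loop (alone forms a c-face); ultraloop (all three); triloop (any of these); proper $\mu$-loop (not an ultraloop). 1-semiloop: an ordinary loop. $\omega$-semiloop: a loop that is its own right successor, or $e$ and its right successor are distinct and form a cutset or their removal decreases the genus. $\omega^2$-semiloop: an $\omega$-loop that is its own left successor, or $e$ and its left successor are distinct and form a cutset or their removal decreases the genus. Proper $\mu$-semiloop: a $\mu$-semiloop that is not a triloop. Reductions of $e=uv$: if $e$ is an $\omega$- or $\omega^2$-loop, $D[1]e=D[\omega]e=D[\omega^2]e$ deletes $e$. Otherwise $D[1]e$ contracts $e$ if $e$ is not a loop; if $e$ is a loop at $v$ with cyclic order of edge-ends $e,a_1,b_1,\dots,a_s,b_s,e,c_1,d_1,\dots,c_t,d_t$ (starting at the outgoing end of $e$), $e$ is removed and $v$ split into $v_1$ (incident with $c_i,d_i$) and $v_2$ (incident with $a_i,b_i$). $D[\omega]e$: with left successor $\ell=vn$, delete $e,\ell$, add new edge $un$ in their place, remove $v$ if $\deg(v)=2$. $D[\omega^2]e$: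 same with right successor $r=vm$, adding $um$. Complete extended Tutte invariant: let $w,x,y,z,a,b,c,d,e,f,g,h,i,j,k,l$ be independent indeterminates over a field $\mathbb{E}$. For an alternating dimap $D$ with a linear order $<$ on $E(D)$ (the ordered dimap $(D,<)$), define the derived polynomial $F(D,<)\in\mathbb{E}[w,\dots,l]$ recursively: $F=1$ for the empty dimap; otherwise, with $r$ the first edge under $<$ and each reduced dimap carrying the induced order on the remaining edges, $F(D)=wF(D\setminus r)$ if $r$ is an ultraloop; $xF(D[1]r)$ if a proper 1-loop; $yF(D[\omega]r)$ if a proper $\omega$-loop; $zF(D[\omega^2]r)$ if a proper $\omega^2$-loop; $aF(D[1]r)+bF(D[\omega]r)+cF(D[\omega^2]r)$ if a proper 1-semiloop; $dF(D[1]r)+eF(D[\omega]r)+fF(D[\omega^2]r)$ if a proper $\omega$-semiloop; $gF(D[1]r)+hF(D[\omega]r)+iF(D[\omega^2]r)$ if a proper $\omega^2$-semiloop; $jF(D[1]r)+kF(D[\omega]r)+lF(D[\omega^2]r)$ otherwise. The complete extended Tutte invariant is well defined for $D$ if all linear orders on $E(D)$ give the same derived polynomial.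
   Formalization: The cases for proper 1-, ω- and ω²-semiloops can overlap in positive genus (e.g. the one-vertex torus with two triangles), so F is ambiguous; here every applicable case yields a derived polynomial, and well defined means all orders and all such choices give the same polynomial. *)

theory Defs
  imports
    "HOL-Library.Poly_Mapping"
    "HOL-Combinatorics.Permutations"
    "HOL-Combinatorics.Orbits"
begin

text \<open>
  Embedded digraphs are given by rotation systems. By the Heffter--Edmonds correspondence, a
  digraph without isolated vertices that is 2-cell embedded in a disjoint union of closed oriented
  surfaces is the same thing as its set of edges together with the permutation taking every
  edge-end to the clockwise next edge-end around its vertex. The vertices are the cycles of this
  permutation.
\<close>

datatype 'e edge_end = is_out: Out (edge_of: 'e) | is_in: In (edge_of: 'e)

fun opposite :: "'e edge_end \<Rightarrow> 'e edge_end" where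
  "opposite (Out e) = In e"
| "opposite (In e) = Out e"

definition edge_ends :: "'e set \<Rightarrow> 'e edge_end set" where
  "edge_ends A = Out ` A \<union> In ` A"

record 'e dimap =
  edges :: "'e set"
  rot :: "'e edge_end \<Rightarrow> 'e edge_end"

definition alternating_dimap :: "'e dimap \<Rightarrow> bool" where
  "alternating_dimap D \<longleftrightarrow>
     finite (edges D) \<and>
     rot D permutes edge_ends (edges D) \<and>
     (\<forall>e \<in> edges D. is_in (rot D (Out e)) \<and> is_out (rot D (In e)))"

definition vertices :: "'e dimap \<Rightarrow> 'e edge_end set set" where
  "vertices D = orbit (rot D) ` edge_ends (edges D)"

definition tail :: "'e dimap \<Rightarrow> 'e \<Rightarrow> 'e edge_end set" where
  "tail D e = orbit (rot D) (Out e)"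

definition head :: "'e dimap \<Rightarrow> 'e \<Rightarrow> 'e edge_end set" where
  "head D e = orbit (rot D) (In e)"

text \<open>
  A face is traced by leaving a vertex through an edge-end \<open>x\<close>, arriving at \<open>opposite x\<close> and
  turning to the clockwise next edge-end; this keeps the face on the left-hand side. Starting from
  \<open>Out e\<close> the edge \<open>e\<close> is traversed forwards, so one gets the a-face on the left of \<open>e\<close>. Starting
  from \<open>In e\<close> all edges are traversed backwards, so one gets the c-face on the right of \<open>e\<close>, in
  reverse; hence the inverse of the rotation in the right successor.
\<close>

definition face :: "('e edge_end \<Rightarrow> 'e edge_end) \<Rightarrow> 'e edge_end \<Rightarrow> 'e edge_end set" where
  "face \<rho> x = orbit (\<rho> \<circ> opposite) x"

definition a_face :: "'e dimap \<Rightarrow> 'e \<Rightarrow> 'e edge_end set" where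
  "a_face D e = face (rot D) (Out e)"

definition c_face :: "'e dimap \<Rightarrow> 'e \<Rightarrow> 'e edge_end set" where
  "c_face D e = face (rot D) (In e)"

definition left_succ :: "'e dimap \<Rightarrow> 'e \<Rightarrow> 'e" where
  "left_succ D e = edge_of (rot D (In e))"

definition right_succ :: "'e dimap \<Rightarrow> 'e \<Rightarrow> 'e" where
  "right_succ D e = edge_of (inv (rot D) (In e))"

text \<open>
  \<open>first_return \<rho> S\<close> is the rotation obtained from \<open>\<rho>\<close> by erasing all edge-ends outside \<open>S\<close> and
  keeping the cyclic order of the others.
\<close>

definition first_return :: "('a \<Rightarrow> 'a) \<Rightarrow> 'a set \<Rightarrow> 'a \<Rightarrow> 'a" where
  "first_return \<rho> S x =
     (if x \<in> S then (\<rho> ^^ (LEAST n. 0 < n \<and> (\<rho> ^^ n) x \<in> S)) x else x)"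

text \<open>
  Components, faces and genus of the embedded graph that has all vertices of \<open>D\<close> but only the edges
  in \<open>A\<close>. It need not be alternating and it may have isolated vertices; each of these is a
  component of its own, lying on a sphere with exactly one face. The genus is the sum of the genera
  of the components, by Euler's formula.
\<close>

definition components :: "'e dimap \<Rightarrow> 'e set \<Rightarrow> 'e edge_end set set set" where
  "components D A =
     (let R = {(tail D e, head D e) | e. e \<in> A}
      in (\<lambda>v. (R \<union> R\<inverse>)\<^sup>* `` {v}) ` vertices D)"

definition num_faces :: "'e dimap \<Rightarrow> 'e set \<Rightarrow> nat" where
  "num_faces D A =
     card (face (first_return (rot D) (edge_ends A)) ` edge_ends A)
     + card {v \<in> vertices D. v \<inter> edge_ends A = {}}"

definition genus :: "'e dimap \<Rightarrow> 'e set \<Rightarrow> int" where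
  "genus D A =
     (2 * int (card (components D A))
      - (int (card (vertices D)) - int (card A) + int (num_faces D A))) div 2"

definition is_cutset :: "'e dimap \<Rightarrow> 'e set \<Rightarrow> bool" where
  "is_cutset D X \<longleftrightarrow> card (components D (edges D)) < card (components D (edges D - X))"

definition removal_decreases_genus :: "'e dimap \<Rightarrow> 'e set \<Rightarrow> bool" where
  "removal_decreases_genus D X \<longleftrightarrow> genus D (edges D - X) < genus D (edges D)"


definition one_loop :: "'e dimap \<Rightarrow> 'e \<Rightarrow> bool" where
  "one_loop D e \<longleftrightarrow> card (head D e) = 2"

definition omega_loop :: "'e dimap \<Rightarrow> 'e \<Rightarrow> bool" where
  "omega_loop D e \<longleftrightarrow> a_face D e = {Out e}"

definition omega2_loop :: "'e dimap \<Rightarrow> 'e \<Rightarrow> bool" where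
  "omega2_loop D e \<longleftrightarrow> c_face D e = {In e}"

definition ultraloop :: "'e dimap \<Rightarrow> 'e \<Rightarrow> bool" where
  "ultraloop D e \<longleftrightarrow> one_loop D e \<and> omega_loop D e \<and> omega2_loop D e"

definition triloop :: "'e dimap \<Rightarrow> 'e \<Rightarrow> bool" where
  "triloop D e \<longleftrightarrow> one_loop D e \<or> omega_loop D e \<or> omega2_loop D e"

definition one_semiloop :: "'e dimap \<Rightarrow> 'e \<Rightarrow> bool" where
  "one_semiloop D e \<longleftrightarrow> tail D e = head D e"

definition omega_semiloop :: "'e dimap \<Rightarrow> 'e \<Rightarrow> bool" where
  "omega_semiloop D e \<longleftrightarrow>
     tail D e = head D e \<and> right_succ D e = e \<or>
     right_succ D e \<noteq> e \<and>
       (is_cutset D {e, right_succ D e} \<or> removal_decreases_genus D {e, right_succ D e})"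

definition omega2_semiloop :: "'e dimap \<Rightarrow> 'e \<Rightarrow> bool" where
  "omega2_semiloop D e \<longleftrightarrow>
     omega_loop D e \<and> left_succ D e = e \<or>
     left_succ D e \<noteq> e \<and>
       (is_cutset D {e, left_succ D e} \<or> removal_decreases_genus D {e, left_succ D e})"

definition proper_loop :: "('e dimap \<Rightarrow> 'e \<Rightarrow> bool) \<Rightarrow> 'e dimap \<Rightarrow> 'e \<Rightarrow> bool" where
  "proper_loop mu_loop D e \<longleftrightarrow> mu_loop D e \<and> \<not> ultraloop D e"

definition proper_semiloop :: "('e dimap \<Rightarrow> 'e \<Rightarrow> bool) \<Rightarrow> 'e dimap \<Rightarrow> 'e \<Rightarrow> bool" where
  "proper_semiloop mu_semiloop D e \<longleftrightarrow> mu_semiloop D e \<and> \<not> triloop D e"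


definition delete_edge :: "'e dimap \<Rightarrow> 'e \<Rightarrow> 'e dimap" where
  "delete_edge D e =
     \<lparr>edges = edges D - {e}, rot = first_return (rot D) (edge_ends (edges D - {e}))\<rparr>"

text \<open>
  If \<open>e\<close> is not a loop, then its ends lie on two cycles \<open>(Out e, A)\<close> and \<open>(In e, B)\<close> of the
  rotation, and the following formula turns them into the single cycle \<open>(A, B)\<close>: this is
  contraction. If \<open>e\<close> is a loop, then its ends lie on one cycle \<open>(Out e, A, In e, B)\<close>, and the
  same formula turns it into the two cycles \<open>(A)\<close> and \<open>(B)\<close>: this is the splitting of the vertex.
\<close>

definition contract_or_split :: "'e dimap \<Rightarrow> 'e \<Rightarrow> 'e dimap" where
  "contract_or_split D e =
     \<lparr>edges = edges D - {e},
      rot = (\<lambda>x. if x \<in> {Out e, In e} then x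
                 else if rot D x = Out e then rot D (In e)
                 else if rot D x = In e then rot D (Out e)
                 else rot D x)\<rparr>"

text \<open>
  Replacing \<open>e\<close> and its (left or right) successor \<open>s\<close> by one edge: the ends \<open>In e\<close> and \<open>Out s\<close> are
  erased, and the new edge consists of the ends \<open>Out e\<close> and \<open>In s\<close>. The new edge inherits the
  name \<open>s\<close>, hence also the position of \<open>s\<close> in any linear order on the edges; so \<open>Out e\<close> is
  renamed to \<open>Out s\<close>. The common vertex of \<open>e\<close> and \<open>s\<close> vanishes if it has no other edge-ends.
\<close>

definition merge_with_succ :: "'e dimap \<Rightarrow> 'e \<Rightarrow> 'e \<Rightarrow> 'e dimap" where
  "merge_with_succ D e s =
     \<lparr>edges = edges D - {e},
      rot = transpose (Out e) (Out s)
            \<circ> first_return (rot D) (edge_ends (edges D) - {In e, Out s})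
            \<circ> transpose (Out e) (Out s)\<rparr>"

definition reduce_one :: "'e dimap \<Rightarrow> 'e \<Rightarrow> 'e dimap" where
  "reduce_one D e =
     (if omega_loop D e \<or> omega2_loop D e then delete_edge D e else contract_or_split D e)"

definition reduce_omega :: "'e dimap \<Rightarrow> 'e \<Rightarrow> 'e dimap" where
  "reduce_omega D e =
     (if omega_loop D e \<or> omega2_loop D e then delete_edge D e
      else merge_with_succ D e (left_succ D e))"

definition reduce_omega2 :: "'e dimap \<Rightarrow> 'e \<Rightarrow> 'e dimap" where
  "reduce_omega2 D e =
     (if omega_loop D e \<or> omega2_loop D e then delete_edge D e
      else merge_with_succ D e (right_succ D e))"


datatype indet = Vw | Vx | Vy | Vz | Va | Vb | Vc | Vd | Ve | Vf | Vg | Vh | Vi | Vj | Vk | Vl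

type_synonym 'k tutte_poly = "(indet \<Rightarrow>\<^sub>0 nat) \<Rightarrow>\<^sub>0 'k"

definition Var :: "indet \<Rightarrow> 'k::field tutte_poly" where
  "Var v = Poly_Mapping.single (Poly_Mapping.single v 1) 1"

definition first_edge :: "'e dimap \<Rightarrow> 'e rel \<Rightarrow> 'e \<Rightarrow> bool" where
  "first_edge D ord r \<longleftrightarrow> r \<in> edges D \<and> (\<forall>s \<in> edges D. (r, s) \<in> ord)"

text \<open>
  The clauses for the three kinds of proper semiloops are not mutually exclusive when the genus is
  positive: for the one-vertex triangulation of the torus with two triangular faces, every edge is
  a proper semiloop of all three kinds. No clause takes precedence, hence a relation rather than a
  function: every clause that applies yields a derived polynomial.
\<close>

inductive derived_poly :: "'e dimap \<Rightarrow> 'e rel \<Rightarrow> 'k::field tutte_poly \<Rightarrow> bool" where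
  empty: "edges D = {} \<Longrightarrow> derived_poly D ord 1"
| ultraloop:
    "\<lbrakk>first_edge D ord r; ultraloop D r;
      derived_poly (delete_edge D r) (Restr ord (edges D - {r})) p\<rbrakk>
     \<Longrightarrow> derived_poly D ord (Var Vw * p)"
| one_loop:
    "\<lbrakk>first_edge D ord r; proper_loop one_loop D r;
      derived_poly (reduce_one D r) (Restr ord (edges D - {r})) p\<rbrakk>
     \<Longrightarrow> derived_poly D ord (Var Vx * p)"
| omega_loop:
    "\<lbrakk>first_edge D ord r; proper_loop omega_loop D r;
      derived_poly (reduce_omega D r) (Restr ord (edges D - {r})) p\<rbrakk>
     \<Longrightarrow> derived_poly D ord (Var Vy * p)"
| omega2_loop:
    "\<lbrakk>first_edge D ord r; proper_loop omega2_loop D r;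
      derived_poly (reduce_omega2 D r) (Restr ord (edges D - {r})) p\<rbrakk>
     \<Longrightarrow> derived_poly D ord (Var Vz * p)"
| one_semiloop:
    "\<lbrakk>first_edge D ord r; proper_semiloop one_semiloop D r;
      derived_poly (reduce_one D r) (Restr ord (edges D - {r})) p;
      derived_poly (reduce_omega D r) (Restr ord (edges D - {r})) q;
      derived_poly (reduce_omega2 D r) (Restr ord (edges D - {r})) s\<rbrakk>
     \<Longrightarrow> derived_poly D ord (Var Va * p + Var Vb * q + Var Vc * s)"
| omega_semiloop:
    "\<lbrakk>first_edge D ord r; proper_semiloop omega_semiloop D r;
      derived_poly (reduce_one D r) (Restr ord (edges D - {r})) p;
      derived_poly (reduce_omega D r) (Restr ord (edges D - {r})) q;
      derived_poly (reduce_omega2 D r) (Restr ord (edges D - {r})) s\<rbrakk>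
     \<Longrightarrow> derived_poly D ord (Var Vd * p + Var Ve * q + Var Vf * s)"
| omega2_semiloop:
    "\<lbrakk>first_edge D ord r; proper_semiloop omega2_semiloop D r;
      derived_poly (reduce_one D r) (Restr ord (edges D - {r})) p;
      derived_poly (reduce_omega D r) (Restr ord (edges D - {r})) q;
      derived_poly (reduce_omega2 D r) (Restr ord (edges D - {r})) s\<rbrakk>
     \<Longrightarrow> derived_poly D ord (Var Vg * p + Var Vh * q + Var Vi * s)"
| otherwise:
    "\<lbrakk>first_edge D ord r; \<not> triloop D r;
      \<not> one_semiloop D r; \<not> omega_semiloop D r; \<not> omega2_semiloop D r;
      derived_poly (reduce_one D r) (Restr ord (edges D - {r})) p;
      derived_poly (reduce_omega D r) (Restr ord (edges D - {r})) q;
      derived_poly (reduce_omega2 D r) (Restr ord (edges D - {r})) s\<rbrakk>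
     \<Longrightarrow> derived_poly D ord (Var Vj * p + Var Vk * q + Var Vl * s)"

text \<open>The type argument is the coefficient field.\<close>

definition complete_extended_tutte_well_defined ::
    "'k::field itself \<Rightarrow> 'e dimap \<Rightarrow> bool" where
  "complete_extended_tutte_well_defined _ D \<longleftrightarrow>
     (\<exists>p :: 'k tutte_poly. \<forall>ord. linear_order_on (edges D) ord \<longrightarrow>
        (\<forall>q. derived_poly D ord q \<longleftrightarrow> q = p))"

end

theory Submission
  imports Defs
begin

text \<open>
  An alternating dimap amounts to two permutations of its edges, the left and the right successor.
  An edge is an \<open>\<omega>\<close>-loop, an \<open>\<omega>\<^sup>2\<close>-loop or a 1-loop iff it is fixed by the first, is fixed by the
  second, or has the same image under both; the first reduction bypasses it in both cycles.

  If all edges are triloops, only this reduction occurs, the reductions of different edges commute,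
  and the types of two edges are exchanged consistently, so the diamond property gives uniqueness.

  Conversely, kill the coefficients of the other two reductions, which leaves a monomial. If \<open>e\<close> is
  not a triloop, then \<open>e\<close> and its two successors are distinct; reduce all other edges first, which
  preserves the successors of \<open>e\<close>. If one of the remaining three edges is a triloop, starting with
  it leaves two edges, both triloops, so the monomial contains only \<open>w, x, y, z\<close>, whereas starting
  with \<open>e\<close> contributes another indeterminate. Otherwise the three edges triangulate the torus with
  two triangles, and \<open>e\<close> is both a 1-semiloop and an \<open>\<omega>\<close>-semiloop.
\<close>

section \<open>Alternating dimaps as pairs of permutations\<close>

lemma edge_ends_iff [simp]: "Out e \<in> edge_ends A \<longleftrightarrow> e \<in> A" "In e \<in> edge_ends A \<longleftrightarrow> e \<in> A"
  by (auto simp: edge_ends_def)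

lemma finite_edge_ends: "finite A \<Longrightarrow> finite (edge_ends A)"
  by (simp add: edge_ends_def)

lemma edge_ends_cases:
  assumes "x \<in> edge_ends A"
  obtains e where "e \<in> A" "x = Out e" | e where "e \<in> A" "x = In e"
  using assms by (auto simp: edge_ends_def)

lemma rot_inject:
  assumes "alternating_dimap D"
  shows "rot D x = rot D y \<longleftrightarrow> x = y"
  using assms by (metis alternating_dimap_def injD permutes_inj)

lemma rot_outside:
  assumes "alternating_dimap D" "x \<notin> edge_ends (edges D)"
  shows "rot D x = x"
  using assms by (meson alternating_dimap_def permutes_not_in)

lemma rot_in_edge_ends:
  assumes "alternating_dimap D"
  shows "rot D x \<in> edge_ends (edges D) \<longleftrightarrow> x \<in> edge_ends (edges D)"
  using assms by (meson alternating_dimap_def permutes_in_image)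

lemma rot_In:
  assumes "alternating_dimap D" "e \<in> edges D"
  shows "rot D (In e) = Out (left_succ D e)"
  using assms by (auto simp: alternating_dimap_def left_succ_def)

lemma left_succ_in_edges:
  assumes "alternating_dimap D" "e \<in> edges D"
  shows "left_succ D e \<in> edges D"
  using assms rot_in_edge_ends[OF assms(1), of "In e"] by (simp add: rot_In)

text \<open>The rotation sends incoming ends to outgoing ones, so the end preceding
  \<open>In e\<close> must be outgoing. This replaces the inverse in \<open>right_succ\<close> by a
  forward equation.\<close>

lemma rot_right_succ:
  assumes "alternating_dimap D" "e \<in> edges D"
  shows "rot D (Out (right_succ D e)) = In e" "right_succ D e \<in> edges D"
proof -
  let ?x = "inv (rot D) (In e)"
  have x: "rot D ?x = In e"
    using assms by (metis alternating_dimap_def permutes_inverses(1))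
  then have "?x \<in> edge_ends (edges D)"
    using assms rot_in_edge_ends by (metis edge_ends_iff(2))
  then obtain f where "f \<in> edges D" "?x = Out f"
    using x assms(1) by (cases rule: edge_ends_cases) (auto simp: rot_In)
  then show "rot D (Out (right_succ D e)) = In e" "right_succ D e \<in> edges D"
    using x by (auto simp: right_succ_def)
qed

lemma right_succ_eq_iff:
  assumes "alternating_dimap D" "e \<in> edges D"
  shows "right_succ D e = f \<longleftrightarrow> rot D (Out f) = In e"
  using rot_right_succ[OF assms] rot_inject[OF assms(1)] by (metis edge_end.inject(1))

lemma left_succ_inject:
  assumes "alternating_dimap D" "e \<in> edges D" "f \<in> edges D"
  shows "left_succ D e = left_succ D f \<longleftrightarrow> e = f"
  using assms rot_In rot_inject by (metis edge_end.inject(2))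

lemma right_succ_inject:
  assumes "alternating_dimap D" "e \<in> edges D" "f \<in> edges D"
  shows "right_succ D e = right_succ D f \<longleftrightarrow> e = f"
  using assms rot_right_succ(1) by (metis edge_end.inject(2))

lemma right_succ_surj:
  assumes "alternating_dimap D" "e \<in> edges D"
  obtains f where "f \<in> edges D" "right_succ D f = e"
proof -
  have "right_succ D ` edges D = edges D"
    using assms(1) by (intro endo_inj_surj)
      (auto simp: alternating_dimap_def rot_right_succ(2)[OF assms(1)] right_succ_inject inj_on_def)
  then show ?thesis
    using assms(2) that by (metis imageE)
qed

text \<open>The left successors determine the rotation at incoming ends. The right successors
  determine it at outgoing ends, because every edge is the right successor of some edge.\<close>

lemma alternating_dimap_eqI:
  fixes D D' :: "'e dimap"
  assumes D: "alternating_dimap D" and D': "alternating_dimap D'"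
    and E: "edges D = edges D'"
    and L: "\<And>e. e \<in> edges D \<Longrightarrow> left_succ D e = left_succ D' e"
    and R: "\<And>e. e \<in> edges D \<Longrightarrow> right_succ D e = right_succ D' e"
  shows "D = D'"
proof -
  have "rot D x = rot D' x" for x
  proof (cases "x \<in> edge_ends (edges D)")
    case True
    then show ?thesis
    proof (cases rule: edge_ends_cases)
      case (1 e)
      then obtain f where "f \<in> edges D" "right_succ D f = e"
        using right_succ_surj[OF D] by blast
      then show ?thesis
        using 1 R rot_right_succ(1)[OF D] rot_right_succ(1)[OF D'] E by metis
    next
      case (2 e)
      then show ?thesis
        using L E by (simp add: rot_In[OF D] rot_In[OF D'])
    qed
  next
    case False
    then show ?thesis
      using rot_outside[OF D] rot_outside[OF D'] E by simp
  qed
  then show ?thesis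
    using E by (intro dimap.equality) auto
qed

section \<open>Loop types in terms of the successors\<close>

lemma omega_loop_iff:
  assumes "alternating_dimap D" "e \<in> edges D"
  shows "omega_loop D e \<longleftrightarrow> left_succ D e = e"
  using rot_In[OF assms] by (simp add: omega_loop_def a_face_def face_def orbit_eq_singleton_iff)

lemma omega2_loop_iff:
  assumes "alternating_dimap D" "e \<in> edges D"
  shows "omega2_loop D e \<longleftrightarrow> right_succ D e = e"
  using right_succ_eq_iff[OF assms]
  by (simp add: omega2_loop_def c_face_def face_def orbit_eq_singleton_iff)

lemma one_loop_iff:
  assumes "alternating_dimap D" "e \<in> edges D"
  shows "one_loop D e \<longleftrightarrow> left_succ D e = right_succ D e"
proof -
  let ?O = "orbit (rot D) (In e)" and ?f = "left_succ D e"
  have rot_f: "rot D (Out ?f) = In e \<longleftrightarrow> ?f = right_succ D e"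
    using right_succ_eq_iff[OF assms] by metis
  have "card ?O = 2 \<longleftrightarrow> rot D (Out ?f) = In e"
  proof
    assume c: "card ?O = 2"
    have perm: "permutation (rot D)"
      using assms(1) finite_edge_ends permutation_permutes by (metis alternating_dimap_def)
    have "In e \<in> ?O"
      by (rule permutation_self_in_orbit[OF perm])
    moreover have f: "Out ?f \<in> ?O"
      using orbit.base[of "rot D" "In e"] rot_In[OF assms] by simp
    moreover have "rot D (Out ?f) \<in> ?O"
      using f by (rule orbit.step)
    \<comment> \<open>In an orbit of size two the end after \<open>Out ?f\<close> is
      \<open>In e\<close> or \<open>Out ?f\<close>; alternation excludes the latter.\<close>
    moreover have "rot D (Out ?f) \<noteq> Out ?f"
      using assms left_succ_in_edges by (metis alternating_dimap_def edge_end.disc(3))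
    ultimately show "rot D (Out ?f) = In e"
      using c by (auto simp: card_2_iff)
  next
    assume f: "rot D (Out ?f) = In e"
    have "?O = {In e, Out ?f}"
    proof (intro equalityI subsetI)
      fix x
      assume "x \<in> ?O"
      then show "x \<in> {In e, Out ?f}"
        using f rot_In[OF assms] by induct auto
    next
      fix x
      assume "x \<in> {In e, Out ?f}"
      then show "x \<in> ?O"
        using f rot_In[OF assms] orbit.base[of "rot D" "In e"] orbit.step[of "Out ?f" "rot D" "In e"]
        by auto
    qed
    then show "card ?O = 2"
      by simp
  qed
  then show ?thesis
    using rot_f by (simp add: one_loop_def head_def)
qed

lemmas loop_iffs = one_loop_iff omega_loop_iff omega2_loop_iff

lemma triloop_iff:
  assumes "alternating_dimap D" "e \<in> edges D"
  shows "triloop D e \<longleftrightarrow>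
    left_succ D e = right_succ D e \<or> left_succ D e = e \<or> right_succ D e = e"
  using assms by (simp add: triloop_def loop_iffs)

section \<open>The first reduction bypasses an edge in both permutations\<close>

text \<open>An end followed by \<open>Out r\<close> is incoming and is redirected to the outgoing
  end \<open>rot D (In r)\<close>; dually for \<open>In r\<close>. So alternation survives, and an
  injective self-map of a finite set is bijective.\<close>

lemma alternating_contract_or_split:
  assumes D: "alternating_dimap D" and r: "r \<in> edges D"
  shows "alternating_dimap (contract_or_split D r)"
proof -
  let ?D' = "contract_or_split D r" and ?S = "edge_ends (edges D - {r})"
  note inj = rot_inject[OF D]
  have S: "x \<in> ?S \<longleftrightarrow> x \<in> edge_ends (edges D) \<and> x \<noteq> Out r \<and> x \<noteq> In r" for x
    by (cases x) auto
  have io: "is_in (rot D (Out e))" "is_out (rot D (In e))" if "e \<in> edges D" for e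
    using D that by (auto simp: alternating_dimap_def)
  have ne: "rot D (Out e) \<noteq> Out f" "rot D (In e) \<noteq> In f" if "e \<in> edges D" for e f
    using io[OF that] by auto
  have maps: "rot ?D' x \<in> ?S" if "x \<in> ?S" for x
    using that r ne[OF r] inj[of x "In r"] inj[of x "Out r"]
    by (auto simp: S contract_or_split_def rot_in_edge_ends[OF D])
  have "inj_on (rot ?D') ?S"
    by (rule inj_onI) (use inj in \<open>auto simp: S contract_or_split_def split: if_splits\<close>, metis+)
  moreover have "finite ?S"
    using D by (simp add: alternating_dimap_def finite_edge_ends)
  ultimately have "bij_betw (rot ?D') ?S ?S"
    using maps by (simp add: bij_betw_def endo_inj_surj image_subset_iff)
  moreover have "rot ?D' x = x" if "x \<notin> ?S" for x
    using that rot_outside[OF D, of x] by (auto simp: S contract_or_split_def)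
  ultimately have "rot ?D' permutes ?S"
    by (rule bij_imp_permutes)
  moreover have "is_in (rot ?D' (Out e))" "is_out (rot ?D' (In e))" if "e \<in> edges D - {r}" for e
    using that ne[of e] io[of e] io[OF r] by (auto simp: contract_or_split_def)
  ultimately show ?thesis
    using D by (auto simp: alternating_dimap_def contract_or_split_def)
qed

section \<open>Deletion of a loop as a first return\<close>

lemma first_return_eqI:
  assumes "x \<in> S" "0 < n" "(\<rho> ^^ n) x \<in> S" "\<And>k. 0 < k \<Longrightarrow> k < n \<Longrightarrow> (\<rho> ^^ k) x \<notin> S"
  shows "first_return \<rho> S x = (\<rho> ^^ n) x"
proof -
  have "(LEAST n. 0 < n \<and> (\<rho> ^^ n) x \<in> S) = n"
    using assms by (intro Least_equality) (auto simp: not_less[symmetric])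
  then show ?thesis
    using assms(1) by (simp add: first_return_def)
qed

lemma first_return_1:
  assumes "x \<in> S" "\<rho> x \<in> S"
  shows "first_return \<rho> S x = \<rho> x"
  using first_return_eqI[of x S 1 \<rho>] assms by simp

text \<open>The erasure of two consecutive ends, as happens when a loop with adjacent ends is
  deleted.\<close>

lemma first_return_3:
  assumes "x \<in> S" "\<rho> x \<notin> S" "\<rho> (\<rho> x) \<notin> S" "\<rho> (\<rho> (\<rho> x)) \<in> S"
  shows "first_return \<rho> S x = \<rho> (\<rho> (\<rho> x))"
proof -
  have "(\<rho> ^^ k) x \<notin> S" if "0 < k" "k < 3" for k
  proof -
    have "k = 1 \<or> k = 2"
      using that by auto
    then show ?thesis
      using assms by (auto simp: numeral_2_eq_2)
  qed
  then show ?thesis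
    using first_return_eqI[of x S 3 \<rho>] assms by (simp add: numeral_3_eq_3)
qed

text \<open>The two ends of an \<omega>-loop or \<open>\<omega>\<^sup>2\<close>-loop are adjacent in
  the rotation. Deletion skips both at once, and the splitting formula then has the same effect, so
  one formula covers all edges.\<close>

lemma reduce_one_eq_contract_or_split:
  assumes D: "alternating_dimap D" and r: "r \<in> edges D"
  shows "reduce_one D r = contract_or_split D r"
proof (cases "omega_loop D r \<or> omega2_loop D r")
  case True
  let ?S = "edge_ends (edges D - {r})"
  note inj = rot_inject[OF D]
  have S: "x \<in> ?S \<longleftrightarrow> x \<in> edge_ends (edges D) \<and> x \<noteq> Out r \<and> x \<noteq> In r" for x
    by (cases x) auto
  have fixed: "rot D (In r) = Out r \<or> rot D (Out r) = In r"
    using True rot_In[OF D r] right_succ_eq_iff[OF D r] by (auto simp: loop_iffs D r)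
  have "first_return (rot D) ?S x = rot (contract_or_split D r) x" for x
  proof (cases "x \<in> ?S")
    case x: True
    show ?thesis
    proof (cases "rot D x \<in> ?S")
      case True
      then show ?thesis
        using x by (simp add: first_return_1 contract_or_split_def S)
    next
      case False
      \<comment> \<open>A remaining end can only be followed by the first of the two adjacent ends
        of \<open>r\<close>; injectivity excludes the second.\<close>
      then consider "rot D x = Out r" "rot D (Out r) = In r" | "rot D x = In r" "rot D (In r) = Out r"
        using fixed x inj by (auto simp: S rot_in_edge_ends[OF D]) metis+
      then show ?thesis
      proof cases
        case 1
        have "rot D (In r) \<in> ?S"
          using 1 x r inj[of "In r" x] inj[of "In r" "Out r"] by (auto simp: S rot_in_edge_ends[OF D])
        then have "first_return (rot D) ?S x = rot D (In r)"
          using 1 x first_return_3[of x ?S "rot D"] by simp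
        moreover have "rot (contract_or_split D r) x = rot D (In r)"
          using 1 x by (simp add: contract_or_split_def S)
        ultimately show ?thesis
          by simp
      next
        case 2
        have "rot D (Out r) \<in> ?S"
          using 2 x r inj[of "Out r" x] inj[of "In r" "Out r"] by (auto simp: S rot_in_edge_ends[OF D])
        then have "first_return (rot D) ?S x = rot D (Out r)"
          using 2 x first_return_3[of x ?S "rot D"] by simp
        moreover have "rot (contract_or_split D r) x = rot D (Out r)"
          using 2 x by (simp add: contract_or_split_def S)
        ultimately show ?thesis
          by simp
      qed
    qed
  next
    case False
    then show ?thesis
      using rot_outside[OF D, of x] r by (auto simp: first_return_def contract_or_split_def S)
  qed
  then show ?thesis
    using True by (simp add: reduce_one_def delete_edge_def contract_or_split_def fun_eq_iff)
qed (simp add: reduce_one_def)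

section \<open>The first reduction on edges and successors\<close>

lemma edges_reduce [simp]:
  "edges (reduce_one D r) = edges D - {r}"
  "edges (reduce_omega D r) = edges D - {r}"
  "edges (reduce_omega2 D r) = edges D - {r}"
  "edges (delete_edge D r) = edges D - {r}"
  by (simp_all add: reduce_one_def reduce_omega_def reduce_omega2_def delete_edge_def
      contract_or_split_def merge_with_succ_def)

lemma alternating_reduce_one:
  assumes "alternating_dimap D" "r \<in> edges D"
  shows "alternating_dimap (reduce_one D r)"
  using assms by (simp add: reduce_one_eq_contract_or_split alternating_contract_or_split)

lemma card_edges_reduce_one_less:
  assumes "alternating_dimap D" "r \<in> edges D"
  shows "card (edges (reduce_one D r)) < card (edges D)"
  using assms by (metis alternating_dimap_def card_Diff1_less edges_reduce(1))

lemma left_succ_reduce_one: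
  assumes "alternating_dimap D" "r \<in> edges D" "e \<in> edges D" "e \<noteq> r"
  shows "left_succ (reduce_one D r) e =
    (if left_succ D e = r then left_succ D r else left_succ D e)"
proof -
  have "rot (reduce_one D r) (In e) =
      Out (if left_succ D e = r then left_succ D r else left_succ D e)"
    using assms by (simp add: reduce_one_eq_contract_or_split contract_or_split_def rot_In)
  then show ?thesis
    by (simp add: left_succ_def)
qed

lemma right_succ_reduce_one:
  assumes D: "alternating_dimap D" and "r \<in> edges D" "e \<in> edges D" "e \<noteq> r"
  shows "right_succ (reduce_one D r) e =
    (if right_succ D e = r then right_succ D r else right_succ D e)"
proof -
  \<comment> \<open>Otherwise \<open>e\<close> and \<open>r\<close> would share a right successor.
    Hence \<open>Out (right_succ D r)\<close> survives, and its next end changes from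
    \<open>In r\<close> to \<open>rot D (Out r)\<close>, which is \<open>In e\<close>.\<close>
  have "right_succ D r \<noteq> r" if "right_succ D e = r"
    using that assms right_succ_inject by metis
  then show ?thesis
    using assms alternating_reduce_one[OF assms(1,2)] rot_right_succ(1)[of D e]
      rot_right_succ(1)[of D r]
    by (subst right_succ_eq_iff)
      (auto simp: reduce_one_eq_contract_or_split contract_or_split_def)
qed

lemmas succ_reduce_one = left_succ_reduce_one right_succ_reduce_one

text \<open>Cutting two elements out of the cycles of a permutation does not depend on the order;
  this is applied to both successor permutations.\<close>

lemma reduce_one_commute:
  assumes D: "alternating_dimap D" and e: "e \<in> edges D" and f: "f \<in> edges D" and "e \<noteq> f"
  shows "reduce_one (reduce_one D e) f = reduce_one (reduce_one D f) e"
proof (rule alternating_dimap_eqI)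
  have fe: "f \<in> edges (reduce_one D e)" "e \<in> edges (reduce_one D f)"
    using assms by auto
  note alt = alternating_reduce_one[OF D e] alternating_reduce_one[OF D f]
  show "alternating_dimap (reduce_one (reduce_one D e) f)"
    "alternating_dimap (reduce_one (reduce_one D f) e)"
    using alt fe by (auto intro: alternating_reduce_one)
  show "edges (reduce_one (reduce_one D e) f) = edges (reduce_one (reduce_one D f) e)"
    by auto
  fix x
  assume "x \<in> edges (reduce_one (reduce_one D e) f)"
  then have x: "x \<in> edges D" "x \<noteq> e" "x \<noteq> f"
    by auto
  show "left_succ (reduce_one (reduce_one D e) f) x = left_succ (reduce_one (reduce_one D f) e) x"
    using x assms fe alt left_succ_inject[OF D] by (auto simp: left_succ_reduce_one)
  show "right_succ (reduce_one (reduce_one D e) f) x = right_succ (reduce_one (reduce_one D f) e) x"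
    using x assms fe alt right_succ_inject[OF D] by (auto simp: right_succ_reduce_one)
qed

text \<open>The only delicate case is \<open>left_succ D e = right_succ D e = r\<close>. Injectivity
  then prevents \<open>r\<close> from being its own successor, so the triloop \<open>r\<close> has
  equal successors, which \<open>e\<close> inherits.\<close>

lemma triloop_reduce_one:
  assumes D: "alternating_dimap D" and r: "r \<in> edges D" "triloop D r"
    and e: "e \<in> edges D" "e \<noteq> r" "triloop D e"
  shows "triloop (reduce_one D r) e"
proof -
  have e': "e \<in> edges (reduce_one D r)"
    using e by simp
  have "left_succ D r \<noteq> left_succ D e" "right_succ D r \<noteq> right_succ D e"
    using e r D by (auto simp: left_succ_inject right_succ_inject)
  moreover have "left_succ D r = right_succ D r \<or> left_succ D r = r \<or> right_succ D r = r"
    "left_succ D e = right_succ D e \<or> left_succ D e = e \<or> right_succ D e = e"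
    using r e triloop_iff[OF D] by auto
  ultimately show ?thesis
    unfolding triloop_iff[OF alternating_reduce_one[OF D r(1)] e']
      left_succ_reduce_one[OF D r(1) e(1,2)] right_succ_reduce_one[OF D r(1) e(1,2)]
    using e(2) by metis
qed

section \<open>Contraction monomials\<close>

text \<open>
  Setting the coefficients of all \<open>D[\<omega>]\<close>- and \<open>D[\<omega>\<^sup>2]\<close>-terms to zero turns a derived polynomial
  into a single monomial in the remaining indeterminates.
\<close>

definition contraction_vars :: "indet set" where
  "contraction_vars = {Vw, Vx, Vy, Vz, Va, Vd, Vg, Vj}"

text \<open>A relation rather than a function, since the semiloop clauses overlap; an edge with two
  weights is what settles the torus case.\<close>

fun contraction_weight :: "'e dimap \<Rightarrow> 'e \<Rightarrow> indet \<Rightarrow> bool" where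
  "contraction_weight D r Vw \<longleftrightarrow> ultraloop D r"
| "contraction_weight D r Vx \<longleftrightarrow> proper_loop one_loop D r"
| "contraction_weight D r Vy \<longleftrightarrow> proper_loop omega_loop D r"
| "contraction_weight D r Vz \<longleftrightarrow> proper_loop omega2_loop D r"
| "contraction_weight D r Va \<longleftrightarrow> proper_semiloop one_semiloop D r"
| "contraction_weight D r Vd \<longleftrightarrow> proper_semiloop omega_semiloop D r"
| "contraction_weight D r Vg \<longleftrightarrow> proper_semiloop omega2_semiloop D r"
| "contraction_weight D r Vj \<longleftrightarrow>
     \<not> triloop D r \<and> \<not> one_semiloop D r \<and> \<not> omega_semiloop D r \<and> \<not> omega2_semiloop D r"
| "contraction_weight D r _ \<longleftrightarrow> False"

text \<open>The edge \<open>r\<close> is arbitrary: only one branch is followed, so a sequence of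
  choices amounts to a linear order on the edges.\<close>

inductive contraction_monomial :: "'e dimap \<Rightarrow> (indet \<Rightarrow>\<^sub>0 nat) \<Rightarrow> bool" where
  empty: "edges D = {} \<Longrightarrow> contraction_monomial D 0"
| step: "\<lbrakk>r \<in> edges D; contraction_weight D r v; contraction_monomial (reduce_one D r) m\<rbrakk>
    \<Longrightarrow> contraction_monomial D (Poly_Mapping.single v 1 + m)"

lemma contraction_monomial_no_edges:
  assumes "contraction_monomial D m" "edges D = {}"
  shows "m = 0"
  using assms by cases auto

lemma contraction_weight_in_vars: "contraction_weight D r v \<Longrightarrow> v \<in> contraction_vars"
  by (cases v) (auto simp: contraction_vars_def)

lemma contraction_weight_exists: "\<exists>v. contraction_weight D r v"
proof (cases "triloop D r")
  case True
  then have "contraction_weight D r Vw \<or> contraction_weight D r Vx \<or> contraction_weight D r Vy \<or>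
      contraction_weight D r Vz"
    by (auto simp: triloop_def proper_loop_def)
  then show ?thesis
    by blast
next
  case False
  then have "contraction_weight D r Va \<or> contraction_weight D r Vd \<or> contraction_weight D r Vg \<or>
      contraction_weight D r Vj"
    by (auto simp: proper_semiloop_def)
  then show ?thesis
    by blast
qed

text \<open>Natural exponents cannot cancel.\<close>

lemma keys_monomial_add:
  "Poly_Mapping.keys (m + m' :: indet \<Rightarrow>\<^sub>0 nat) = Poly_Mapping.keys m \<union> Poly_Mapping.keys m'"
  by (auto simp: in_keys_iff lookup_add)

lemma keys_contraction_monomial:
  assumes "contraction_monomial D m"
  shows "Poly_Mapping.keys m \<subseteq> contraction_vars"
  using assms by induct (auto simp: keys_monomial_add dest: contraction_weight_in_vars)

text \<open>The kernel of the specialisation.\<close>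

definition negligible :: "'k::field tutte_poly \<Rightarrow> bool" where
  "negligible p \<longleftrightarrow> (\<forall>m \<in> Poly_Mapping.keys p. \<not> Poly_Mapping.keys m \<subseteq> contraction_vars)"

lemma negligible_add: "negligible p \<Longrightarrow> negligible q \<Longrightarrow> negligible (p + q)"
  using keys_add[of p q] by (auto simp: negligible_def)

lemma negligible_diff: "negligible p \<Longrightarrow> negligible q \<Longrightarrow> negligible (p - q)"
  by (auto simp: negligible_def in_keys_iff lookup_minus)

text \<open>Every monomial of the product is a multiple of a monomial of \<open>q\<close> and keeps
  its forbidden indeterminate, so the negligible polynomials form an ideal.\<close>

lemma negligible_mult: "negligible q \<Longrightarrow> negligible (p * q)"
  using keys_mult[of p q] by (fastforce simp: negligible_def keys_monomial_add)

lemma negligible_Var_mult: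
  assumes "v \<notin> contraction_vars"
  shows "negligible (Var v * q)"
proof -
  have "negligible (Var v :: 'a tutte_poly)"
    using assms by (auto simp: negligible_def Var_def)
  then show ?thesis
    using negligible_mult by (metis mult.commute)
qed

text \<open>Congruence to a monomial modulo this ideal, which avoids an evaluation
  homomorphism.\<close>

definition specialises_to :: "'k::field tutte_poly \<Rightarrow> (indet \<Rightarrow>\<^sub>0 nat) \<Rightarrow> bool" where
  "specialises_to p m \<longleftrightarrow> negligible (p - Poly_Mapping.single m 1)"

lemma Var_mult_single:
  "Var v * Poly_Mapping.single m (1 :: 'k::field) =
    Poly_Mapping.single (Poly_Mapping.single v 1 + m) 1"
  by (simp add: Var_def mult_single)

lemma specialises_to_Var_mult:
  assumes "specialises_to p m"
  shows "specialises_to (Var v * p) (Poly_Mapping.single v 1 + m)"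
  using negligible_mult[of "p - Poly_Mapping.single m 1" "Var v"] assms
  by (simp only: specialises_to_def right_diff_distrib Var_mult_single)

lemma specialises_to_add:
  assumes "specialises_to p m" "negligible q"
  shows "specialises_to (p + q) m"
  using negligible_add[of "p - Poly_Mapping.single m 1" q] assms
  by (simp add: specialises_to_def algebra_simps)

text \<open>The difference of the two monomials is negligible. If they were distinct,
  \<open>m\<close> would occur in it with coefficient 1, although it contains no forbidden
  indeterminate.\<close>

lemma specialises_to_unique:
  assumes "specialises_to p m" "specialises_to p m'" "Poly_Mapping.keys m \<subseteq> contraction_vars"
  shows "m = m'"
proof (rule ccontr)
  assume "m \<noteq> m'"
  have "negligible (Poly_Mapping.single m 1 - Poly_Mapping.single m' 1 :: 'a tutte_poly)"
    using negligible_diff[OF assms(2,1)[unfolded specialises_to_def]] by simp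
  moreover have "m \<in> Poly_Mapping.keys
      (Poly_Mapping.single m 1 - Poly_Mapping.single m' 1 :: 'a tutte_poly)"
    using \<open>m \<noteq> m'\<close> by (simp add: in_keys_iff lookup_minus lookup_single when_def)
  ultimately show False
    using assms(3) by (auto simp: negligible_def)
qed

section \<open>Derived polynomials for a given order\<close>

lemma linear_order_on_Restr:
  assumes "linear_order_on A r" "B \<subseteq> A"
  shows "linear_order_on B (Restr r B)"
  using assms total_on_subset[of A r B]
  by (auto simp: order_on_defs refl_on_def trans_Restr antisym_def total_on_def)

lemma linear_order_on_finite_least:
  assumes "linear_order_on A r" "finite B" "B \<noteq> {}" "B \<subseteq> A"
  shows "\<exists>x \<in> B. \<forall>y \<in> B. (x, y) \<in> r"
  using assms(2,3,4)
proof (induction rule: finite_ne_induct)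
  case (singleton x)
  then show ?case
    using assms(1) by (auto simp: order_on_defs refl_on_def)
next
  case (insert x F)
  then obtain y where y: "y \<in> F" "\<forall>z \<in> F. (y, z) \<in> r"
    by auto
  have r: "trans r" "refl_on A r" "total_on A r"
    using assms(1) by (auto simp: order_on_defs)
  show ?case
  proof (cases "(y, x) \<in> r")
    case True
    then show ?thesis
      using y by auto
  next
    case False
    moreover have "x \<in> A" "y \<in> A" "x \<noteq> y"
      using insert y by auto
    ultimately have "(x, y) \<in> r" "(x, x) \<in> r"
      using r by (auto simp: total_on_def refl_on_def)
    then show ?thesis
      using y r(1) by (auto dest: transD)
  qed
qed

text \<open>Some clause always applies to the first edge. The result also supplies the terms of the
  two reductions that the specialisation kills, since the clauses require them.\<close>

lemma derived_poly_exists: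
  fixes D :: "'e dimap"
  assumes "finite (edges D)" "linear_order_on (edges D) ord"
  shows "\<exists>p :: 'k::field tutte_poly. derived_poly D ord p"
  using assms
proof (induction "card (edges D)" arbitrary: D ord rule: less_induct)
  case less
  show ?case
  proof (cases "edges D = {}")
    case True
    then show ?thesis
      by (blast intro: derived_poly.empty)
  next
    case False
    then obtain r where r: "first_edge D ord r"
      using linear_order_on_finite_least[OF less.prems(2,1)] by (auto simp: first_edge_def)
    then have "r \<in> edges D"
      by (simp add: first_edge_def)
    let ?ord = "Restr ord (edges D - {r})"
    \<comment> \<open>Stated for every dimap on the remaining edges, so that it covers all four
      reductions.\<close>
    have IH: "\<exists>p :: 'k tutte_poly. derived_poly D' ?ord p" if "edges D' = edges D - {r}" for D'
    proof (rule less.hyps)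
      show "card (edges D') < card (edges D)"
        using that less.prems(1) \<open>r \<in> edges D\<close> by (metis card_Diff1_less)
    qed (use that less.prems in \<open>auto intro: linear_order_on_Restr\<close>)
    obtain p q s t :: "'k tutte_poly" where
      "derived_poly (reduce_one D r) ?ord p" "derived_poly (reduce_omega D r) ?ord q"
      "derived_poly (reduce_omega2 D r) ?ord s" "derived_poly (delete_edge D r) ?ord t"
      using IH edges_reduce by metis
    note der = r this
    show ?thesis
    proof (cases "triloop D r")
      case True
      then consider "ultraloop D r" | "proper_loop one_loop D r" | "proper_loop omega_loop D r"
        | "proper_loop omega2_loop D r"
        by (auto simp: triloop_def proper_loop_def)
      then show ?thesis
        by cases (use der in \<open>blast intro: derived_poly.intros\<close>)+
    next
      case False
      then consider "proper_semiloop one_semiloop D r" | "proper_semiloop omega_semiloop D r"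
        | "proper_semiloop omega2_semiloop D r"
        | "\<not> one_semiloop D r" "\<not> omega_semiloop D r" "\<not> omega2_semiloop D r"
        by (auto simp: proper_semiloop_def)
      then show ?thesis
        by cases (use der False in \<open>blast intro: derived_poly.intros\<close>)+
    qed
  qed
qed

text \<open>The choices made in the monomial are read off as an order, and each weight selects the
  clause of \<open>derived_poly\<close> with the same leading indeterminate.\<close>

lemma contraction_monomial_realised:
  assumes "contraction_monomial D m" "finite (edges D)"
  shows "\<exists>ord (p :: 'k::field tutte_poly).
    linear_order_on (edges D) ord \<and> derived_poly D ord p \<and> specialises_to p m"
  using assms
proof induction
  case (empty D)
  then have "linear_order_on (edges D) {}" "derived_poly D {} (1 :: 'k tutte_poly)"
    "specialises_to (1 :: 'k tutte_poly) 0"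
    by (auto simp: specialises_to_def negligible_def intro: derived_poly.empty)
  then show ?case
    by blast
next
  case (step r D v m)
  then obtain ord' and p :: "'k tutte_poly" where
    ord': "linear_order_on (edges D - {r}) ord'" and
    p: "derived_poly (reduce_one D r) ord' p" "specialises_to p m"
    by auto
  \<comment> \<open>The chosen edge is placed below the order obtained for the remaining
    edges.\<close>
  define ord where "ord = ord' \<union> {r} \<times> edges D"
  have sub: "ord' \<subseteq> (edges D - {r}) \<times> (edges D - {r})"
    using ord' by (simp add: order_on_defs)
  have lin: "linear_order_on (edges D) ord"
    using ord' \<open>r \<in> edges D\<close> sub
    by (auto simp: ord_def order_on_defs refl_on_def total_on_def antisym_def trans_def; blast)
  have first: "first_edge D ord r"
    using \<open>r \<in> edges D\<close> by (auto simp: first_edge_def ord_def)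
  have restr: "Restr ord (edges D - {r}) = ord'"
    using sub by (auto simp: ord_def)
  obtain q s :: "'k tutte_poly" where
    qs: "derived_poly (reduce_omega D r) ord' q" "derived_poly (reduce_omega2 D r) ord' s"
    using derived_poly_exists[of _ ord'] ord' step.prems
    by (metis edges_reduce(2,3) finite_Diff)
  have loop: "specialises_to (Var v * p) (Poly_Mapping.single v 1 + m)"
    using p(2) by (rule specialises_to_Var_mult)
  have semiloop: "specialises_to (Var v * p + Var b * q + Var c * s) (Poly_Mapping.single v 1 + m)"
    if "b \<notin> contraction_vars" "c \<notin> contraction_vars" for b c
    using that loop by (intro specialises_to_add negligible_Var_mult)
  have "\<exists>p :: 'k tutte_poly. derived_poly D ord p \<and> specialises_to p (Poly_Mapping.single v 1 + m)"
  proof (cases v)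
    case Vw
    \<comment> \<open>For ultraloops and proper \<omega>- and \<open>\<omega>\<^sup>2\<close>-loops
      the prescribed reduction is deletion, as is \<open>reduce_one\<close>.\<close>
    then have "ultraloop D r" "delete_edge D r = reduce_one D r"
      using step.hyps(2) by (auto simp: reduce_one_def ultraloop_def)
    then show ?thesis
      using derived_poly.ultraloop[OF first, of p] p restr loop Vw by auto
  next
    case Vx
    then show ?thesis
      using derived_poly.one_loop[OF first, of p] p restr loop step.hyps(2) by auto
  next
    case Vy
    then have "proper_loop omega_loop D r" "reduce_omega D r = reduce_one D r"
      using step.hyps(2) by (auto simp: reduce_one_def reduce_omega_def proper_loop_def)
    then show ?thesis
      using derived_poly.omega_loop[OF first, of p] p restr loop Vy by auto
  next
    case Vz
    then have "proper_loop omega2_loop D r" "reduce_omega2 D r = reduce_one D r"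
      using step.hyps(2) by (auto simp: reduce_one_def reduce_omega2_def proper_loop_def)
    then show ?thesis
      using derived_poly.omega2_loop[OF first, of p] p restr loop Vz by auto
  next
    case Va
    then show ?thesis
      using derived_poly.one_semiloop[OF first, of p q s] p qs restr semiloop[of Vb Vc] step.hyps(2)
      by (auto simp: contraction_vars_def)
  next
    case Vd
    then show ?thesis
      using derived_poly.omega_semiloop[OF first, of p q s] p qs restr semiloop[of Ve Vf] step.hyps(2)
      by (auto simp: contraction_vars_def)
  next
    case Vg
    then show ?thesis
      using derived_poly.omega2_semiloop[OF first, of p q s] p qs restr semiloop[of Vh Vi] step.hyps(2)
      by (auto simp: contraction_vars_def)
  next
    case Vj
    then show ?thesis
      using derived_poly.otherwise[OF first, of p q s] p qs restr semiloop[of Vk Vl] step.hyps(2)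
      by (auto simp: contraction_vars_def)
  qed (use step.hyps(2) in auto)
  then show ?case
    using lin by blast
qed

lemma well_defined_imp_contraction_monomial_unique:
  assumes "complete_extended_tutte_well_defined TYPE('k::field) D" "finite (edges D)"
    and "contraction_monomial D m" "contraction_monomial D m'"
  shows "m = m'"
proof -
  obtain p :: "'k tutte_poly" where
    p: "\<And>ord q. linear_order_on (edges D) ord \<Longrightarrow> derived_poly D ord q \<longleftrightarrow> q = p"
    using assms(1) by (auto simp: complete_extended_tutte_well_defined_def)
  have "specialises_to p m" if m: "contraction_monomial D m" for m
  proof -
    obtain ord and q :: "'k tutte_poly" where
      "linear_order_on (edges D) ord" "derived_poly D ord q" "specialises_to q m"
      using contraction_monomial_realised[OF m assms(2)] by blast
    then show ?thesis
      using p by simp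
  qed
  then show ?thesis
    using specialises_to_unique keys_contraction_monomial[OF assms(3)] assms(3,4) by metis
qed

section \<open>Dimaps consisting of triloops\<close>

text \<open>Written through successors so that \<open>succ_reduce_one\<close> computes it after a
  reduction. Testing for \<open>Vw\<close> first makes the later cases proper loops.\<close>

definition loop_var :: "'e dimap \<Rightarrow> 'e \<Rightarrow> indet" where
  "loop_var D r =
     (if left_succ D r = r \<and> right_succ D r = r then Vw
      else if left_succ D r = right_succ D r then Vx
      else if left_succ D r = r then Vy else Vz)"

lemma contraction_weight_triloop_iff:
  assumes "alternating_dimap D" "r \<in> edges D" "triloop D r"
  shows "contraction_weight D r v \<longleftrightarrow> v = loop_var D r"
  using assms
  by (cases v) (auto simp: loop_var_def ultraloop_def proper_loop_def proper_semiloop_def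
      triloop_iff loop_iffs)

lemma loop_var_in: "loop_var D r \<in> {Vw, Vx, Vy, Vz}"
  by (simp add: loop_var_def)

text \<open>Reducing one edge changes the type of the other only if both successor permutations
  preserve \<open>{e, f}\<close>. In that case \<open>e\<close> and \<open>f\<close> have the same
  type and whichever survives is an ultraloop.\<close>

lemma loop_var_exchange:
  assumes D: "alternating_dimap D" and e: "e \<in> edges D" "triloop D e"
    and f: "f \<in> edges D" "triloop D f" and "e \<noteq> f"
  shows "loop_var D e = loop_var D f \<and> loop_var (reduce_one D e) f = loop_var (reduce_one D f) e \<or>
    loop_var D e = loop_var (reduce_one D f) e \<and> loop_var (reduce_one D e) f = loop_var D f"
proof -
  have "left_succ D e \<noteq> left_succ D f" "right_succ D e \<noteq> right_succ D f"
    using assms by (auto simp: left_succ_inject right_succ_inject)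
  then show ?thesis
    using assms e(2)[unfolded triloop_iff[OF D e(1)]] f(2)[unfolded triloop_iff[OF D f(1)]]
    unfolding loop_var_def by (auto simp: succ_reduce_one)
qed

section \<open>Existence and uniqueness of the monomial for triloops\<close>

lemma contraction_monomial_triloops_exists:
  assumes "alternating_dimap D" "\<forall>e \<in> edges D. triloop D e"
  shows "\<exists>m. contraction_monomial D m \<and> Poly_Mapping.keys m \<subseteq> {Vw, Vx, Vy, Vz}"
  using assms
proof (induction "card (edges D)" arbitrary: D)
  case 0
  then have "edges D = {}"
    by (auto simp: alternating_dimap_def)
  then show ?case
    using contraction_monomial.empty by fastforce
next
  case (Suc n)
  then obtain r where r: "r \<in> edges D"
    by fastforce
  then obtain m where m: "contraction_monomial (reduce_one D r) m"
      "Poly_Mapping.keys m \<subseteq> {Vw, Vx, Vy, Vz}"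
    using Suc.hyps(1)[of "reduce_one D r"] Suc.hyps(2)[symmetric] Suc.prems
    by (auto simp: alternating_reduce_one triloop_reduce_one)
  have "contraction_monomial D (Poly_Mapping.single (loop_var D r) 1 + m)"
    using r m Suc.prems by (intro contraction_monomial.step) (auto simp: contraction_weight_triloop_iff)
  moreover have "Poly_Mapping.keys (Poly_Mapping.single (loop_var D r) 1 + m) \<subseteq> {Vw, Vx, Vy, Vz}"
    using m loop_var_in[of D r] by (auto simp: keys_monomial_add)
  ultimately show ?case
    by blast
qed

lemma contraction_monomial_triloops_unique:
  assumes "alternating_dimap D" "\<forall>e \<in> edges D. triloop D e"
    and "contraction_monomial D m" "contraction_monomial D m'"
  shows "m = m'"
  using assms
proof (induction "card (edges D)" arbitrary: D m m' rule: less_induct)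
  case less
  note D = less.prems(1) and tri = less.prems(2)
  have red: "alternating_dimap (reduce_one D r)" "\<forall>e \<in> edges (reduce_one D r). triloop (reduce_one D r) e"
    "card (edges (reduce_one D r)) < card (edges D)" if "r \<in> edges D" for r
    using that D tri card_edges_reduce_one_less[OF D that]
    by (auto simp: alternating_reduce_one triloop_reduce_one)
  show ?case
  proof (cases "edges D = {}")
    case True
    then show ?thesis
      using contraction_monomial_no_edges less.prems(3,4) by blast
  next
    case False
    obtain e m1 where e: "e \<in> edges D" "contraction_monomial (reduce_one D e) m1"
        "m = Poly_Mapping.single (loop_var D e) 1 + m1"
      using less.prems(3) False D tri
      by (cases rule: contraction_monomial.cases) (auto simp: contraction_weight_triloop_iff)
    obtain f m2 where f: "f \<in> edges D" "contraction_monomial (reduce_one D f) m2"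
        "m' = Poly_Mapping.single (loop_var D f) 1 + m2"
      using less.prems(4) False D tri
      by (cases rule: contraction_monomial.cases) (auto simp: contraction_weight_triloop_iff)
    show ?thesis
    proof (cases "e = f")
      case True
      then have "m1 = m2"
        using less.hyps[of "reduce_one D e" m1 m2] red[OF e(1)] e f by blast
      then show ?thesis
        using True e f by simp
    next
      case False
      \<comment> \<open>The diamond: both first choices lead to \<open>?D'\<close>. By induction
        \<open>m1\<close> and \<open>m2\<close> may be computed through it, and the exchange of
        types makes the two products agree.\<close>
      let ?D' = "reduce_one (reduce_one D e) f"
      have fe: "f \<in> edges (reduce_one D e)" "e \<in> edges (reduce_one D f)"
        using False e f by auto
      have "alternating_dimap ?D'" "\<forall>x \<in> edges ?D'. triloop ?D' x"
        using red[OF e(1)] fe by (auto simp: alternating_reduce_one triloop_reduce_one)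
      then obtain m3 where m3: "contraction_monomial ?D' m3"
        using contraction_monomial_triloops_exists by blast
      have "contraction_monomial (reduce_one D e)
          (Poly_Mapping.single (loop_var (reduce_one D e) f) 1 + m3)"
        using m3 fe red[OF e(1)]
        by (intro contraction_monomial.step) (auto simp: contraction_weight_triloop_iff)
      then have "m1 = Poly_Mapping.single (loop_var (reduce_one D e) f) 1 + m3"
        using less.hyps red[OF e(1)] e(2) by blast
      moreover have "contraction_monomial (reduce_one D f)
          (Poly_Mapping.single (loop_var (reduce_one D f) e) 1 + m3)"
        using m3 fe red[OF f(1)] reduce_one_commute[OF D e(1) f(1) False]
        by (intro contraction_monomial.step) (auto simp: contraction_weight_triloop_iff)
      then have "m2 = Poly_Mapping.single (loop_var (reduce_one D f) e) 1 + m3"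
        using less.hyps red[OF f(1)] f(2) by blast
      ultimately show ?thesis
        using loop_var_exchange[OF D e(1) _ f(1) _ False] tri e f
        by (auto simp: add.left_commute)
    qed
  qed
qed

text \<open>Only the loop clauses apply, each with a single term, so the derived polynomial itself
  is a monomial without any specialisation.\<close>

lemma derived_poly_triloops:
  assumes "derived_poly D ord (p :: 'k::field tutte_poly)"
    and "alternating_dimap D" "\<forall>e \<in> edges D. triloop D e"
  shows "\<exists>m. contraction_monomial D m \<and> p = Poly_Mapping.single m 1"
proof -
  \<comment> \<open>Shared by the four loop clauses, whose reductions all agree with
    \<open>reduce_one\<close>.\<close>
  have step: "\<exists>m. contraction_monomial D m \<and> Var v * p = Poly_Mapping.single m 1"
    if "first_edge D ord r" "contraction_weight D r v" "D' = reduce_one D r"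
      and D: "alternating_dimap D" "\<forall>e \<in> edges D. triloop D e"
      and IH: "alternating_dimap D' \<Longrightarrow> \<forall>e \<in> edges D'. triloop D' e \<Longrightarrow>
        \<exists>m. contraction_monomial D' m \<and> p = Poly_Mapping.single m 1"
    for D D' :: "'e dimap" and ord r v and p :: "'k tutte_poly"
  proof -
    have r: "r \<in> edges D"
      using that(1) by (simp add: first_edge_def)
    have "alternating_dimap D'" "\<forall>e \<in> edges D'. triloop D' e"
      using D r by (auto simp: \<open>D' = reduce_one D r\<close> alternating_reduce_one triloop_reduce_one)
    then obtain m where "contraction_monomial D' m" "p = Poly_Mapping.single m 1"
      using IH by auto
    then show ?thesis
      using contraction_monomial.step[OF r that(2)] \<open>D' = reduce_one D r\<close> Var_mult_single by metis
  qed
  show ?thesis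
    using assms
  proof induction
    case (empty D ord)
    then show ?case
      by (metis contraction_monomial.empty single_one)
  next
    case (ultraloop D ord r p)
    then show ?case
      by (intro step[OF ultraloop.hyps(1) _ _ _ _ ultraloop.IH])
        (auto simp: reduce_one_def ultraloop_def)
  next
    case (one_loop D ord r p)
    then show ?case
      by (intro step[OF one_loop.hyps(1) _ _ _ _ one_loop.IH]) auto
  next
    case (omega_loop D ord r p)
    then show ?case
      by (intro step[OF omega_loop.hyps(1) _ _ _ _ omega_loop.IH])
        (auto simp: reduce_one_def reduce_omega_def proper_loop_def)
  next
    case (omega2_loop D ord r p)
    then show ?case
      by (intro step[OF omega2_loop.hyps(1) _ _ _ _ omega2_loop.IH])
        (auto simp: reduce_one_def reduce_omega2_def proper_loop_def)
  next
    case one_semiloop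
    then show ?case
      by (meson first_edge_def proper_semiloop_def)
  next
    case omega_semiloop
    then show ?case
      by (meson first_edge_def proper_semiloop_def)
  next
    case omega2_semiloop
    then show ?case
      by (meson first_edge_def proper_semiloop_def)
  next
    case otherwise
    then show ?case
      by (meson first_edge_def)
  qed
qed

lemma triloops_imp_well_defined:
  assumes "alternating_dimap D" "\<forall>e \<in> edges D. triloop D e"
  shows "complete_extended_tutte_well_defined TYPE('k::field) D"
proof -
  obtain m where m: "contraction_monomial D m"
    using contraction_monomial_triloops_exists[OF assms] by blast
  have eq: "q = Poly_Mapping.single m 1" if "derived_poly D ord q" for ord and q :: "'k tutte_poly"
    using derived_poly_triloops[OF that assms] contraction_monomial_triloops_unique[OF assms _ m]
    by blast
  \<comment> \<open>The converse direction needs that every order yields some derived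
    polynomial.\<close>
  have "derived_poly D ord q \<longleftrightarrow> q = Poly_Mapping.single m 1"
    if "linear_order_on (edges D) ord" for ord and q :: "'k tutte_poly"
    using eq derived_poly_exists[where 'k='k, OF _ that] assms(1)
    by (auto simp: alternating_dimap_def)
  then show ?thesis
    by (auto simp: complete_extended_tutte_well_defined_def)
qed

section \<open>Dimaps with an edge that is not a triloop\<close>

text \<open>Among two edges, \<open>e\<close> and its two successors cannot be distinct.\<close>

lemma triloop_if_two_edges:
  assumes "alternating_dimap D" "edges D = {a, b}" "e \<in> edges D"
  shows "triloop D e"
  using assms left_succ_in_edges[OF assms(1,3)] rot_right_succ(2)[OF assms(1,3)]
  by (auto simp: triloop_iff)

lemma orbit_three_cycle:
  assumes "f x = y" "f y = z" "f z = x"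
  shows "orbit f x = {x, y, z}"
proof (intro equalityI subsetI)
  fix u
  assume "u \<in> orbit f x"
  then show "u \<in> {x, y, z}"
    using assms by induct auto
next
  have "f x \<in> orbit f x" "f (f x) \<in> orbit f x" "f (f (f x)) \<in> orbit f x"
    by (auto intro: orbit.intros)
  then show "u \<in> orbit f x" if "u \<in> {x, y, z}" for u
    using that assms by auto
qed

text \<open>
  The one-vertex triangulation of the torus by two triangles. Its edges are semiloops of every
  kind, and no other ambiguity is available: its automorphism group is transitive on the edges.
\<close>

lemma torus_triangle_semiloops:
  assumes D: "alternating_dimap D" and E: "edges D = {e, f, g}"
    and dist: "e \<noteq> f" "e \<noteq> g" "f \<noteq> g"
    and left: "left_succ D e = f" "left_succ D f = g" "left_succ D g = e"
    and right: "right_succ D e = g" "right_succ D g = f" "right_succ D f = e"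
  shows "one_semiloop D e" "omega_semiloop D e"
proof -
  let ?\<rho> = "rot D"
  have rot: "?\<rho> (In e) = Out f" "?\<rho> (In f) = Out g" "?\<rho> (In g) = Out e"
    "?\<rho> (Out g) = In e" "?\<rho> (Out f) = In g" "?\<rho> (Out e) = In f"
    using rot_In[OF D] rot_right_succ(1)[OF D] left right E by (metis insertCI)+
  have perm: "permutation ?\<rho>"
    using D finite_edge_ends permutation_permutes by (metis alternating_dimap_def)
  note step = permutation_orbit_step[OF perm]
  let ?v = "orbit ?\<rho> (In e)"
  \<comment> \<open>All six ends lie on one cycle of the rotation, so there is a single
    vertex.\<close>
  have orb: "orbit ?\<rho> (Out f) = ?v" "orbit ?\<rho> (In g) = ?v" "orbit ?\<rho> (Out e) = ?v"
    "orbit ?\<rho> (In f) = ?v" "orbit ?\<rho> (Out g) = ?v"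
    using step[of "In e"] step[of "Out f"] step[of "In g"] step[of "Out e"] step[of "In f"] rot
    by auto
  have ends: "edge_ends (edges D) = {Out e, Out f, Out g, In e, In f, In g}"
    by (auto simp: edge_ends_def E)
  show "one_semiloop D e"
    using orb by (simp add: one_semiloop_def tail_def head_def)
  have V: "vertices D = {?v}"
    using orb by (simp add: vertices_def ends)
  have comp: "card (components D A) = 1" for A
    by (simp add: components_def V Let_def)
  have ne: "?v \<inter> edge_ends A \<noteq> {}" if "A \<inter> {e, f, g} \<noteq> {}" for A
    using that permutation_self_in_orbit[OF perm] orb by (auto simp: disjoint_iff) (metis edge_ends_iff)+
  define \<phi> where "\<phi> = first_return ?\<rho> (edge_ends (edges D)) \<circ> opposite"
  \<comment> \<open>With no end erased, the faces are those of the rotation itself: two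
    triangles.\<close>
  have "first_return ?\<rho> (edge_ends (edges D)) x = ?\<rho> x" for x
    using first_return_1[of x "edge_ends (edges D)" ?\<rho>] rot_in_edge_ends[OF D] rot_outside[OF D]
    by (cases "x \<in> edge_ends (edges D)") (auto simp: first_return_def)
  then have \<phi>: "\<phi> (Out e) = Out f" "\<phi> (Out f) = Out g" "\<phi> (Out g) = Out e"
    "\<phi> (In e) = In f" "\<phi> (In f) = In g" "\<phi> (In g) = In e"
    using rot by (auto simp: \<phi>_def)
  have Out: "orbit \<phi> (Out e) = {Out e, Out f, Out g}" "orbit \<phi> (Out f) = {Out e, Out f, Out g}"
    "orbit \<phi> (Out g) = {Out e, Out f, Out g}"
    using orbit_three_cycle[OF \<phi>(1-3)] orbit_three_cycle[OF \<phi>(2,3,1)]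
      orbit_three_cycle[OF \<phi>(3,1,2)] by auto
  have In: "orbit \<phi> (In e) = {In e, In f, In g}" "orbit \<phi> (In f) = {In e, In f, In g}"
    "orbit \<phi> (In g) = {In e, In f, In g}"
    using orbit_three_cycle[OF \<phi>(4-6)] orbit_three_cycle[OF \<phi>(5,6,4)]
      orbit_three_cycle[OF \<phi>(6,4,5)] by auto
  have "orbit \<phi> ` edge_ends (edges D) = {{Out e, Out f, Out g}, {In e, In f, In g}}"
    unfolding ends image_insert image_empty Out In by simp
  moreover have "{Out e, Out f, Out g} \<noteq> {In e, In f, In g}"
    by auto
  moreover have "face (first_return ?\<rho> (edge_ends (edges D))) = orbit \<phi>"
    by (simp add: fun_eq_iff face_def \<phi>_def)
  ultimately have "card (face (first_return ?\<rho> (edge_ends (edges D))) ` edge_ends (edges D)) = 2"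
    by simp
  moreover have "{v \<in> vertices D. v \<inter> edge_ends (edges D) = {}} = {}"
    using ne[of "edges D"] by (auto simp: V E)
  ultimately have "num_faces D (edges D) = 2"
    by (simp only: num_faces_def card.empty add_0_right)
  moreover have "card (edges D) = 3"
    using dist by (simp add: E)
  \<comment> \<open>Euler's formula: \<open>(2 * 1 - (1 - 3 + 2)) div 2 = 1\<close>.\<close>
  ultimately have genus: "genus D (edges D) = 1"
    by (simp add: genus_def comp V)
  \<comment> \<open>Removing \<open>e\<close> and its right successor \<open>g\<close> leaves one
    loop with two faces, of genus \<open>(2 * 1 - (1 - 1 + 2)) div 2 = 0\<close>.\<close>
  have A: "edges D - {e, g} = {f}"
    using dist by (auto simp: E)
  let ?\<psi> = "first_return ?\<rho> (edge_ends {f})"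
  have "?\<psi> (Out f) = In f" "?\<psi> (In f) = Out f"
    using first_return_3[of "Out f" "edge_ends {f}" ?\<rho>]
      first_return_3[of "In f" "edge_ends {f}" ?\<rho>] rot dist by auto
  then have "face ?\<psi> (Out f) = {Out f}" "face ?\<psi> (In f) = {In f}"
    by (auto simp: face_def orbit_eq_singleton_iff)
  then have "face ?\<psi> ` edge_ends {f} = {{Out f}, {In f}}"
    by (auto simp: edge_ends_def)
  moreover have "{v \<in> vertices D. v \<inter> edge_ends {f} = {}} = {}"
    using ne[of "{f}"] by (auto simp: V)
  ultimately have "num_faces D {f} = 2"
    by (simp only: num_faces_def card.empty) simp
  then have "genus D {f} = 0"
    by (simp add: genus_def comp V)
  then have "removal_decreases_genus D {e, right_succ D e}"
    by (simp add: removal_decreases_genus_def A genus right)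
  then show "omega_semiloop D e"
    using right(1) dist by (simp add: omega_semiloop_def)
qed

section \<open>Two different monomials from an edge that is not a triloop\<close>

lemma contraction_monomial_exists:
  assumes "finite (edges D)"
  shows "\<exists>m. contraction_monomial D m"
  using assms
proof (induction "card (edges D)" arbitrary: D)
  case 0
  then show ?case
    using contraction_monomial.empty by fastforce
next
  case (Suc n)
  then obtain r where r: "r \<in> edges D"
    by fastforce
  then obtain m where "contraction_monomial (reduce_one D r) m"
    using Suc.hyps(1)[of "reduce_one D r"] Suc.hyps(2)[symmetric] Suc.prems by auto
  then show ?case
    using contraction_weight_exists[of D r] contraction_monomial.step[OF r] by blast
qed

lemma contraction_monomial_ambiguous_three_edges:
  assumes D: "alternating_dimap D" and E: "edges D = {e, left_succ D e, right_succ D e}"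
    and e: "\<not> triloop D e"
  shows "\<exists>m m'. contraction_monomial D m \<and> contraction_monomial D m' \<and> m \<noteq> m'"
proof -
  define f g where "f = left_succ D e" and "g = right_succ D e"
  have eE: "e \<in> edges D" and fE: "f \<in> edges D" and gE: "g \<in> edges D" and E': "edges D = {e, f, g}"
    using E by (auto simp: f_def g_def)
  have dist: "e \<noteq> f" "e \<noteq> g" "f \<noteq> g"
    using e by (auto simp: triloop_iff[OF D eE] f_def g_def)
  obtain m where m: "contraction_monomial (reduce_one D e) m"
    using contraction_monomial_exists[of "reduce_one D e"] D by (auto simp: alternating_dimap_def)
  show ?thesis
  proof (cases "triloop D f \<or> triloop D g")
    case True
    then obtain r where r: "r \<in> edges D" "triloop D r"
      using fE gE by auto
    then have "r \<noteq> e"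
      using e by auto
    obtain v where v: "contraction_weight D e v"
      using contraction_weight_exists[of D e] by auto
    \<comment> \<open>This indeterminate occurs when \<open>e\<close> is reduced first, but not when
      the triloop \<open>r\<close> is, since only two edges then remain.\<close>
    then have "v \<notin> {Vw, Vx, Vy, Vz}"
      using e by (auto simp: triloop_def proper_loop_def ultraloop_def)
    moreover have "\<exists>a b. edges D - {r} = {a, b}"
      using r(1) dist unfolding E' by auto
    then have "\<forall>x \<in> edges (reduce_one D r). triloop (reduce_one D r) x"
      using triloop_if_two_edges alternating_reduce_one[OF D r(1)] by (metis edges_reduce(1))
    then obtain m' where m': "contraction_monomial (reduce_one D r) m'"
        "Poly_Mapping.keys m' \<subseteq> {Vw, Vx, Vy, Vz}"
      using contraction_monomial_triloops_exists alternating_reduce_one[OF D r(1)] by blast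
    have "v \<in> Poly_Mapping.keys (Poly_Mapping.single v 1 + m)"
      by (simp add: keys_monomial_add)
    moreover have "Poly_Mapping.keys (Poly_Mapping.single (loop_var D r) 1 + m') \<subseteq> {Vw, Vx, Vy, Vz}"
      using m'(2) loop_var_in[of D r] by (auto simp: keys_monomial_add)
    ultimately have "Poly_Mapping.single v 1 + m \<noteq> Poly_Mapping.single (loop_var D r) 1 + m'"
      by auto
    then show ?thesis
      using contraction_monomial.step[OF eE v m]
        contraction_monomial.step[OF r(1) _ m'(1), of "loop_var D r"] r D
      by (auto simp: contraction_weight_triloop_iff)
  next
    case False
    have succ: "left_succ D e = f" "right_succ D e = g"
      by (auto simp: f_def g_def)
    \<comment> \<open>Without triloops everything is forced: \<open>left_succ D g\<close> is neither
      \<open>f\<close> nor \<open>g\<close>, hence \<open>e\<close>, and then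
      \<open>left_succ D f\<close> is \<open>g\<close>; likewise for the right successors.\<close>
    have inj: "left_succ D f \<noteq> f" "left_succ D g \<noteq> f" "left_succ D f \<noteq> left_succ D g"
      "right_succ D f \<noteq> g" "right_succ D g \<noteq> g" "right_succ D f \<noteq> right_succ D g"
      using False dist succ left_succ_inject[OF D] right_succ_inject[OF D] eE fE gE
      by (auto simp: triloop_iff[OF D])
    have "left_succ D g = e" "left_succ D f = g" "right_succ D f = e" "right_succ D g = f"
      using False inj left_succ_in_edges[OF D fE] left_succ_in_edges[OF D gE]
        rot_right_succ(2)[OF D fE] rot_right_succ(2)[OF D gE]
      by (auto simp: E' triloop_iff[OF D fE] triloop_iff[OF D gE])
    then have "one_semiloop D e" "omega_semiloop D e"
      using torus_triangle_semiloops[OF D E' dist] succ by auto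
    then have "contraction_weight D e Va" "contraction_weight D e Vd"
      using e by (auto simp: proper_semiloop_def)
    then have "contraction_monomial D (Poly_Mapping.single Va 1 + m)"
      "contraction_monomial D (Poly_Mapping.single Vd 1 + m)"
      by (simp_all only: contraction_monomial.step[OF eE _ m])
    moreover have "Poly_Mapping.single Va (1 :: nat) + m \<noteq> Poly_Mapping.single Vd 1 + m"
    proof
      assume "Poly_Mapping.single Va (1 :: nat) + m = Poly_Mapping.single Vd 1 + m"
      then have "Poly_Mapping.keys (Poly_Mapping.single Va (1 :: nat)) =
          Poly_Mapping.keys (Poly_Mapping.single Vd (1 :: nat))"
        by simp
      then show False
        by simp
    qed
    ultimately show ?thesis
      by blast
  qed
qed

text \<open>Reducing an edge other than \<open>e\<close> and its two successors leaves both
  successors of \<open>e\<close> unchanged, so induction descends to the three-edge case.\<close>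

lemma contraction_monomial_ambiguous:
  assumes "alternating_dimap D" "e \<in> edges D" "\<not> triloop D e"
  shows "\<exists>m m'. contraction_monomial D m \<and> contraction_monomial D m' \<and> m \<noteq> m'"
  using assms
proof (induction "card (edges D)" arbitrary: D rule: less_induct)
  case less
  note D = less.prems(1) and e = less.prems(2,3)
  have sub: "{e, left_succ D e, right_succ D e} \<subseteq> edges D"
    using e(1) left_succ_in_edges[OF D] rot_right_succ(2)[OF D] by auto
  show ?case
  proof (cases "edges D = {e, left_succ D e, right_succ D e}")
    case True
    then show ?thesis
      using contraction_monomial_ambiguous_three_edges[OF D _ e(2)] by blast
  next
    case False
    then obtain r where r: "r \<in> edges D" "r \<noteq> e" "r \<noteq> left_succ D e" "r \<noteq> right_succ D e"
      using sub by blast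
    then have "\<not> triloop (reduce_one D r) e"
      using e D alternating_reduce_one[OF D r(1)] by (auto simp: triloop_iff succ_reduce_one)
    moreover have "card (edges (reduce_one D r)) < card (edges D)"
      using D r(1) by (rule card_edges_reduce_one_less)
    ultimately obtain m m' where m: "contraction_monomial (reduce_one D r) m"
      "contraction_monomial (reduce_one D r) m'" "m \<noteq> m'"
      using less.hyps[of "reduce_one D r"] alternating_reduce_one[OF D r(1)] e(1) r(2) by auto
    \<comment> \<open>Any weight of \<open>r\<close> serves: the same factor on both monomials keeps
      them different.\<close>
    obtain v where "contraction_weight D r v"
      using contraction_weight_exists[of D r] by auto
    then show ?thesis
      using m contraction_monomial.step[OF r(1)] by (metis add_left_cancel)
  qed
qed

theorem theorem6p4:
  fixes D :: "'e dimap"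
  assumes "alternating_dimap D"
  shows "complete_extended_tutte_well_defined TYPE('k::field) D \<longleftrightarrow> (\<forall>e \<in> edges D. triloop D e)"
proof
  assume wd: "complete_extended_tutte_well_defined TYPE('k) D"
  have "finite (edges D)"
    using assms by (simp add: alternating_dimap_def)
  then show "\<forall>e \<in> edges D. triloop D e"
    using contraction_monomial_ambiguous[OF assms]
      well_defined_imp_contraction_monomial_unique[OF wd] by metis
next
  assume "\<forall>e \<in> edges D. triloop D e"
  then show "complete_extended_tutte_well_defined TYPE('k) D"
    by (rule triloops_imp_well_defined[OF assms])
qed

end
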